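(* Let $\alpha>0$ and consider three particles of mass $1$ in $\mathbb{R}^2$ moving according to $\ddot q_i=\partial U/\partial q_i$, $i=1,2,3$, with the $\alpha$-homogeneous potential $U(q_1,q_2,q_3)=\sum_{1\le i<j\le 3}\|q_i-q_j\|^{-\alpha}$. Let $z_0=(1,0,-\tfrac12,\tfrac{\sqrt3}{2},-\tfrac12,-\tfrac{\sqrt3}{2})^T\in\mathbb{R}^6$ be the vertices of the equilateral triangle inscribed in the unit circle, and let $\omega>0$ be the angular velocity for which the uniform rotation of $z_0$ about the origin is a solution, namely $\omega^2=3^{-\alpha/2}\alpha$. Then for every $\alpha>0$ the corresponding relative equilibrium is (linearly) unstable: the linearized system at it has an eigenvalue with positive real part.
   Context: A configuration $z=(a_1,\dots,a_n)\in(\mathbb{R}^2)^n$ together with $\omega>0$ defines a relative equilibrium if $q_i(t)=\exp(-\omega Jt)a_i$, where $J=\begin{pmatrix}0&1\\-1&0\end{pmatrix}$ and hence $\exp(-\omega Jt)=\begin{pmatrix}\cos\omega t&-\sin\omega t\\ \sin\omega t&\cos\omega t\end{pmatrix}$, solves the equations of motion. In the rotating coordinates $q_i=\exp(-\omega Jt)x_i$ the equations become $\ddot x_i=2\omega J\dot x_i+\omega^2x_i+\nabla_{x_i}U$ (unit masses), and the relative equilibrium becomes the equilibrium $x=z$. The linearized system at it is $\ddot X=2\omega\mathbf{J}\dot X+\omega^2X+D^2U(z)X$ for $X\in\mathbb{R}^{2n}$, where $\mathbf{J}=\mathrm{diag}(J,\dots,J)$ ($n$ blocks) and $D^2U(z)$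 is the Hessian of $U$ at $z$. Its eigenvalues are those of the $4n\times4n$ matrix $\begin{pmatrix}0&I_{2n}\\ \omega^2I_{2n}+D^2U(z)&2\omega\mathbf{J}\end{pmatrix}$. The relative equilibrium is called (linearly) unstable if this matrix has an eigenvalue with positive real part. *)

theory Defs
  imports "HOL-Analysis.Analysis" "Jordan_Normal_Form.Char_Poly"
begin

no_notation Matrix.vec_index (infixl "$" 100)

text \<open>
  Planar configurations of three particles are elements of \<open>real^2^3\<close>; \<open>q $ i\<close> is the position
  of particle \<open>i\<close>. The numeral types \<open>2\<close> and \<open>3\<close> carry the order induced from representatives
  \<open>0, 1, ..\<close>, so that \<open>3 = 0\<close> is the least index of type \<open>3\<close>; this is immaterial below, since
  \<open>i < j\<close> only serves to pick every pair once.
\<close>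

definition potential :: "real \<Rightarrow> real^2^3 \<Rightarrow> real" where
  "potential \<alpha> q = (\<Sum>(i, j) \<in> {(i, j). i < j}. norm (q $ i - q $ j) powr (- \<alpha>))"

text \<open>
  \<open>GDERIV\<close> is the gradient for the Euclidean inner product of the whole configuration space; its
  \<open>i\<close>-th component is the partial gradient with respect to the position of particle \<open>i\<close>. At a collision
  (where Isabelle's \<open>0 powr (- \<alpha>) = 0\<close>) the potential is not differentiable for positive \<open>\<alpha>\<close>, so
  solutions are automatically free of collisions.
\<close>

definition solves_newton :: "real \<Rightarrow> (real \<Rightarrow> real^2^3) \<Rightarrow> bool" where
  "solves_newton \<alpha> q \<longleftrightarrow>
     (\<exists>v a. \<forall>t. (q has_vector_derivative v t) (at t) \<and>
                (v has_vector_derivative a t) (at t) \<and>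
                GDERIV (potential \<alpha>) (q t) :> a t)"

definition rotation :: "real \<Rightarrow> real^2^2" where
  "rotation \<theta> = vector [vector [cos \<theta>, - sin \<theta>],
                        vector [sin \<theta>,   cos \<theta>]]"

definition relative_equilibrium :: "real \<Rightarrow> real \<Rightarrow> real^2^3 \<Rightarrow> bool" where
  "relative_equilibrium \<alpha> \<omega> z \<longleftrightarrow>
     \<omega> > 0 \<and> solves_newton \<alpha> (\<lambda>t. \<chi> i. rotation (\<omega> * t) *v (z $ i))"

definition gradient :: "('a::real_inner \<Rightarrow> real) \<Rightarrow> 'a \<Rightarrow> 'a" where
  "gradient f x = (THE g. GDERIV f x :> g)"

text \<open>
  The standard basis of the configuration space in the order
  \<open>(x\<^sub>1, y\<^sub>1, x\<^sub>2, y\<^sub>2, x\<^sub>3, y\<^sub>3)\<close>. Matrices are indexed from \<open>0\<close>, components of vectors from \<open>1\<close>.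
\<close>

definition coord :: "nat \<Rightarrow> real^2^3" where
  "coord k = axis (of_nat (k div 2 + 1)) (axis (of_nat (k mod 2 + 1)) 1)"

text \<open>
  \<open>hessian f z\<close> is meaningful if \<open>f\<close> is differentiable near \<open>z\<close> with gradient differentiable at
  \<open>z\<close>, as is the case for the potential at configurations without collisions.
\<close>

definition hessian :: "(real^2^3 \<Rightarrow> real) \<Rightarrow> real^2^3 \<Rightarrow> real mat" where
  "hessian f z =
     Matrix.mat 6 6 (\<lambda>(k, l). coord k \<bullet> frechet_derivative (gradient f) (at z) (coord l))"

definition J2 :: "real mat" where
  "J2 = mat_of_rows_list 2 [[0, 1], [-1, 0]]"

definition J6 :: "real mat" where
  "J6 = diag_block_mat [J2, J2, J2]"

definition linearization :: "real \<Rightarrow> real \<Rightarrow> real^2^3 \<Rightarrow> real mat" where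
  "linearization \<alpha> \<omega> z =
     four_block_mat
       (0\<^sub>m 6 6)                                    (1\<^sub>m 6)
       (\<omega>\<^sup>2 \<cdot>\<^sub>m 1\<^sub>m 6 + hessian (potential \<alpha>) z)   ((2 * \<omega>) \<cdot>\<^sub>m J6)"

definition linearly_unstable :: "real \<Rightarrow> real \<Rightarrow> real^2^3 \<Rightarrow> bool" where
  "linearly_unstable \<alpha> \<omega> z \<longleftrightarrow>
     (\<exists>\<mu>::complex. eigenvalue (map_mat complex_of_real (linearization \<alpha> \<omega> z)) \<mu> \<and> Re \<mu> > 0)"

definition z0 :: "real^2^3" where
  "z0 = vector [vector [1, 0], vector [- 1/2, sqrt 3 / 2], vector [- 1/2, - (sqrt 3 / 2)]]"

end

theory Submission
  imports Defs
begin

text \<open>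
  With \<open>\<zeta> = exp (2 * \<pi> * \<i> / 3)\<close>, the configurations whose \<open>k\<close>-th particle sits at
  \<open>a * \<zeta> powi (- k)\<close>, \<open>a\<close> complex, form a real plane of shape deformations of the triangle on
  which the Hessian acts as the scalar \<open>\<omega>\<^sup>2 * \<alpha> / 2\<close> and which \<open>J6\<close> maps to itself.
  On its complexification \<open>J6\<close> has the eigenvalue \<open>\<i>\<close>, and the eigenvalue equation becomes
  \<open>\<mu>\<^sup>2 = 2 * \<omega> * \<i> * \<mu> + \<omega>\<^sup>2 + \<omega>\<^sup>2 * \<alpha> / 2\<close>, that is
  \<open>(\<mu> - \<i> * \<omega>)\<^sup>2 = \<omega>\<^sup>2 * \<alpha> / 2\<close>. The root
  \<open>\<mu> = \<omega> * (sqrt (\<alpha> / 2) + \<i>)\<close> has positive real part for every \<open>\<alpha> > 0\<close>.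
\<close>

no_notation scalar_prod (infix "\<bullet>" 70)

section \<open>Gradient of the potential away from collisions\<close>

lemma pairs_3: "{(i, j). i < j} = {(3, 1), (3, 2), (1, 2 :: 3)}"
proof -
  have rep: "Rep_bit1 (1 :: 3) = 1" "Rep_bit1 (2 :: 3) = 2" "Rep_bit1 (3 :: 3) = 0"
    using bit1.Rep_1[where 'a = num1] bit1.Rep_numeral[where 'a = num1, of "num.Bit0 num.One"]
      bit1.Rep_numeral[where 'a = num1, of "num.Bit1 num.One"]
    by simp_all
  have "i < j \<longleftrightarrow> (i, j) \<in> {(3, 1), (3, 2), (1, 2)}" for i j :: 3
    using exhaust_3[of i] exhaust_3[of j] by (elim disjE; simp add: less_bit1_def rep)
  then show ?thesis by blast
qed

text \<open>Writing the derivative with \<open>norm x powr (p - 2)\<close> and \<open>x\<close> in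
  place of \<open>sgn x\<close> keeps it in the same family of functions, so the rule serves twice:
  with exponent \<open>- \<alpha>\<close> for the potential and \<open>- \<alpha> - 2\<close> for
  the force.\<close>

lemma norm_powr_has_derivative:
  fixes x :: "'a::real_inner"
  assumes "x \<noteq> 0"
  shows "((\<lambda>x. norm x powr p) has_derivative (\<lambda>h. p * norm x powr (p - 2) * (x \<bullet> h))) (at x)"
proof -
  have "((\<lambda>x. norm x powr p) has_derivative
      (\<lambda>h. norm x powr p * (0 * ln (norm x) + (h \<bullet> sgn x) * p / norm x))) (at x)"
    using assms by (intro has_derivative_powr has_derivative_const has_derivative_norm) auto
  moreover have "norm x powr p * (0 * ln (norm x) + (h \<bullet> sgn x) * p / norm x)
      = p * norm x powr (p - 2) * (x \<bullet> h)" for h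
    using assms by (simp add: powr_diff sgn_div_norm power2_eq_square field_simps inner_commute)
  ultimately show ?thesis by simp
qed

lemma pair_norm_powr_has_derivative:
  fixes q :: "'a::real_inner^'n"
  assumes "q $ i \<noteq> q $ j"
  shows "((\<lambda>q. norm (q $ i - q $ j) powr p) has_derivative
     (\<lambda>h. p * norm (q $ i - q $ j) powr (p - 2) * ((q $ i - q $ j) \<bullet> (h $ i - h $ j)))) (at q)"
  using assms
  by (intro has_derivative_compose[OF _ norm_powr_has_derivative, where f="\<lambda>q. q $ i - q $ j"]
    has_derivative_diff bounded_linear_imp_has_derivative bounded_linear_vec_nth) simp

text \<open>Closed form of the gradient of the potential. The sum may include \<open>j = i\<close>,
  since that summand is a multiple of the zero vector.\<close>

definition force :: "real \<Rightarrow> real^2^3 \<Rightarrow> real^2^3" where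
  "force \<alpha> q =
     (\<chi> i. \<Sum>j\<in>UNIV. (- \<alpha> * norm (q $ i - q $ j) powr (- \<alpha> - 2)) *\<^sub>R (q $ i - q $ j))"

definition collision_free :: "real^2^3 \<Rightarrow> bool" where
  "collision_free q \<longleftrightarrow> (\<forall>i j. i \<noteq> j \<longrightarrow> q $ i \<noteq> q $ j)"

text \<open>Supplies the neighbourhood on which \<open>gradient (potential \<alpha>)\<close> agrees
  with \<open>force \<alpha>\<close>, so that the derivative of one is that of the other.\<close>

lemma open_collision_free: "open {q. collision_free q}"
proof -
  have "{q. collision_free q} = (\<Inter>i. \<Inter>j\<in>- {i}. {q. q $ i \<noteq> q $ j})"
    by (auto simp: collision_free_def)
  moreover have "open {q :: real^2^3. q $ i \<noteq> q $ j}" for i j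
    by (intro open_Collect_neq continuous_intros)
  ultimately show ?thesis by (auto intro!: open_INT)
qed

lemma GDERIV_potential:
  assumes "collision_free q"
  shows "GDERIV (potential \<alpha>) q :> force \<alpha> q"
proof -
  let ?d = "\<lambda>i j h. - \<alpha> * norm (q $ i - q $ j) powr (- \<alpha> - 2)
    * ((q $ i - q $ j) \<bullet> (h $ i - h $ j))"
  have "(potential \<alpha> has_derivative (\<lambda>h. ?d 3 1 h + (?d 3 2 h + ?d 1 2 h))) (at q)"
  proof -
    have "potential \<alpha> = (\<lambda>q. norm (q $ 3 - q $ 1) powr (- \<alpha>)
        + (norm (q $ 3 - q $ 2) powr (- \<alpha>) + norm (q $ 1 - q $ 2) powr (- \<alpha>)))"
      by (simp add: fun_eq_iff potential_def pairs_3)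
    then show ?thesis
      using assms unfolding collision_free_def
      by (simp only:) (intro has_derivative_add pair_norm_powr_has_derivative; simp)
  qed
  moreover have "?d 3 1 h + (?d 3 2 h + ?d 1 2 h) = h \<bullet> force \<alpha> q" for h
  proof -
    define c where "c i j = - \<alpha> * norm (q $ i - q $ j) powr (- \<alpha> - 2)" for i j
    \<comment> \<open>The double sum below runs over ordered pairs, the potential over unordered
      ones; symmetry of the coefficients merges \<open>(i, j)\<close> and
      \<open>(j, i)\<close>.\<close>
    have c: "c 1 3 = c 3 1" "c 2 3 = c 3 2" "c 2 1 = c 1 2"
      by (simp_all add: c_def norm_minus_commute)
    have "h \<bullet> force \<alpha> q = (\<Sum>i\<in>UNIV. \<Sum>j\<in>UNIV. c i j * (h $ i \<bullet> (q $ i - q $ j)))"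
      by (simp only: force_def c_def inner_vec_def[of h] vec_lambda_beta inner_sum_right inner_scaleR_right)
    then show ?thesis
      unfolding c_def[symmetric] inner_commute[of "q $ _ - q $ _"]
      by (simp add: sum_3 c inner_diff_left inner_diff_right algebra_simps)
  qed
  ultimately show ?thesis unfolding gderiv_def by (simp only:)
qed

lemma GDERIV_unique:
  assumes "GDERIV f x :> a" and "GDERIV f x :> b"
  shows "a = b"
proof -
  have "(\<lambda>h. h \<bullet> a) = (\<lambda>h. h \<bullet> b)"
    using assms unfolding gderiv_def by (rule has_derivative_unique)
  then have "h \<bullet> a = h \<bullet> b" for h by meson
  from this[of "a - b"] show ?thesis
    by (metis inner_diff_right inner_eq_zero_iff right_minus_eq)
qed

lemma gradient_potential: "collision_free q \<Longrightarrow> gradient (potential \<alpha>) q = force \<alpha> q"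
  unfolding gradient_def using GDERIV_potential GDERIV_unique by blast

section \<open>The rotating triangle and its angular velocity\<close>

text \<open>Equal sides make all pair coefficients equal, and with the centre of mass at the origin
  the differences \<open>q $ i - q $ j\<close> sum to \<open>3 *\<^sub>R q $ i\<close>. Hence the
  force is central.\<close>

lemma force_equilateral:
  assumes dist: "\<And>i j. i \<noteq> j \<Longrightarrow> norm (q $ i - q $ j) = sqrt 3" and center: "(\<Sum>i\<in>UNIV. q $ i) = 0"
  shows "force \<alpha> q = - (3 powr (- \<alpha> / 2) * \<alpha>) *\<^sub>R q"
proof -
  have p: "sqrt 3 powr (- \<alpha> - 2) = 3 powr (- \<alpha> / 2) / 3"
    by (simp add: powr_half_sqrt[symmetric] powr_powr powr_diff)
  have "force \<alpha> q $ i = - (3 powr (- \<alpha> / 2) * \<alpha>) *\<^sub>R q $ i" for i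
  proof -
    \<comment> \<open>The common coefficient may also be used for \<open>j = i\<close>, where the
      vector is zero.\<close>
    have "force \<alpha> q $ i = (\<Sum>j\<in>UNIV. (- \<alpha> * (3 powr (- \<alpha> / 2) / 3)) *\<^sub>R (q $ i - q $ j))"
      unfolding force_def vec_lambda_beta by (intro sum.cong refl) (metis dist p right_minus_eq scaleR_zero_right)
    also have "\<dots> = (- \<alpha> * (3 powr (- \<alpha> / 2) / 3)) *\<^sub>R (3 *\<^sub>R q $ i)"
      unfolding scaleR_sum_right[symmetric] sum_subtractf center sum_constant_scaleR by simp
    finally show ?thesis by simp
  qed
  then show ?thesis by (simp add: Finite_Cartesian_Product.vec_eq_iff)
qed

text \<open>\<open>z0\<close> after a counterclockwise quarter turn of every particle, so that
  rotating \<open>z0\<close> traces a circle in the plane spanned by the two.\<close>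

definition z0_perp :: "real^2^3" where
  "z0_perp = vector [vector [0, 1], vector [- (sqrt 3 / 2), - 1/2], vector [sqrt 3 / 2, - 1/2]]"

lemma rotation_z0:
  "(\<chi> i. rotation \<theta> *v (z0 $ i)) = cos \<theta> *\<^sub>R z0 + sin \<theta> *\<^sub>R z0_perp"
  by (simp add: Finite_Cartesian_Product.vec_eq_iff forall_3 forall_2 z0_def z0_perp_def rotation_def
    matrix_vector_mult_def sum_2)

text \<open>Corresponding sides of \<open>z0\<close> and \<open>z0_perp\<close> are orthogonal and
  of length \<open>sqrt 3\<close>, so the length is preserved by
  \<open>sin\<^sup>2 + cos\<^sup>2 = 1\<close>. The angle 0 gives \<open>z0\<close> itself.\<close>

lemma norm_rotated_z0_diff:
  assumes "i \<noteq> j" and "q = cos \<theta> *\<^sub>R z0 + sin \<theta> *\<^sub>R z0_perp"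
  shows "norm (q $ i - q $ j) = sqrt 3"
proof -
  let ?d = "z0 $ i - z0 $ j" and ?d' = "z0_perp $ i - z0_perp $ j"
  have d: "?d \<bullet> ?d = 3" "?d' \<bullet> ?d' = 3" "?d \<bullet> ?d' = 0"
    using assms(1) exhaust_3[of i] exhaust_3[of j]
    by (auto simp: inner_vec_def sum_2 z0_def z0_perp_def field_simps)
  have "q $ i - q $ j = cos \<theta> *\<^sub>R ?d + sin \<theta> *\<^sub>R ?d'"
    by (simp add: assms(2) algebra_simps)
  then have "(norm (q $ i - q $ j))\<^sup>2 = 3 * ((sin \<theta>)\<^sup>2 + (cos \<theta>)\<^sup>2)"
    unfolding power2_norm_eq_inner
    by (simp only: inner_add_left inner_add_right inner_scaleR_left inner_scaleR_right d
      inner_commute[of ?d' ?d]) (simp add: power2_eq_square)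
  then have "(norm (q $ i - q $ j))\<^sup>2 = 3" by simp
  then show ?thesis by (simp add: real_sqrt_unique)
qed

lemma z0_collision_free: "collision_free z0"
  unfolding collision_free_def
proof (intro allI impI)
  fix i j :: 3 assume "i \<noteq> j"
  from norm_rotated_z0_diff[OF this, of z0 0] show "z0 $ i \<noteq> z0 $ j" by auto
qed

lemma force_rotated_z0:
  fixes \<alpha> \<theta> :: real
  defines "q \<equiv> cos \<theta> *\<^sub>R z0 + sin \<theta> *\<^sub>R z0_perp"
  shows "GDERIV (potential \<alpha>) q :> - (3 powr (- \<alpha> / 2) * \<alpha>) *\<^sub>R q"
proof -
  have dist: "norm (q $ i - q $ j) = sqrt 3" if "i \<noteq> j" for i j
    using norm_rotated_z0_diff[OF that] q_def by simp
  then have "collision_free q"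
    unfolding collision_free_def by (metis norm_zero real_sqrt_eq_zero_cancel_iff right_minus_eq zero_neq_numeral)
  moreover have "(\<Sum>i\<in>UNIV. q $ i) = 0"
    by (simp add: q_def sum_3 Finite_Cartesian_Product.vec_eq_iff forall_2 z0_def z0_perp_def)
  ultimately have "force \<alpha> q = - (3 powr (- \<alpha> / 2) * \<alpha>) *\<^sub>R q"
    using force_equilateral[OF dist] by blast
  then show ?thesis
    using GDERIV_potential[OF \<open>collision_free q\<close>, of \<alpha>] by (simp only:)
qed

text \<open>Uniform rotation has acceleration \<open>- w\<^sup>2 *\<^sub>R q t\<close>, while the
  force is \<open>- ?c *\<^sub>R q t\<close>; the two agree exactly when the scalars do.\<close>

lemma relative_equilibrium_z0_iff:
  assumes "w > 0"
  shows "relative_equilibrium \<alpha> w z0 \<longleftrightarrow> w\<^sup>2 = 3 powr (- \<alpha> / 2) * \<alpha>" (is "_ \<longleftrightarrow> w\<^sup>2 = ?c")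
proof -
  define q where "q t = cos (w * t) *\<^sub>R z0 + sin (w * t) *\<^sub>R z0_perp" for t
  define v where "v t = (- w * sin (w * t)) *\<^sub>R z0 + (w * cos (w * t)) *\<^sub>R z0_perp" for t
  have q': "(q has_vector_derivative v t) (at t)" for t
    unfolding q_def[abs_def] v_def
    by (auto intro!: derivative_eq_intros
      simp: has_real_derivative_iff_has_vector_derivative[symmetric] mult.commute)
  have v': "(v has_vector_derivative - w\<^sup>2 *\<^sub>R q t) (at t)" for t
    unfolding q_def v_def[abs_def]
    by (auto intro!: derivative_eq_intros simp: has_real_derivative_iff_has_vector_derivative[symmetric]
      power2_eq_square algebra_simps)
  have grad: "GDERIV (potential \<alpha>) (q t) :> - ?c *\<^sub>R q t" for t
    unfolding q_def by (rule force_rotated_z0)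
  have "solves_newton \<alpha> q \<longleftrightarrow> w\<^sup>2 = ?c"
  proof
    assume "w\<^sup>2 = ?c"
    then show "solves_newton \<alpha> q"
      unfolding solves_newton_def
      using q' v' grad by (intro exI[of _ v] exI[of _ "\<lambda>t. - w\<^sup>2 *\<^sub>R q t"]) simp
  next
    assume "solves_newton \<alpha> q"
    then obtain v2 a where *: "\<And>t. (q has_vector_derivative v2 t) (at t)"
      "\<And>t. (v2 has_vector_derivative a t) (at t)" "\<And>t. GDERIV (potential \<alpha>) (q t) :> a t"
      unfolding solves_newton_def by blast
    \<comment> \<open>Velocity, acceleration and gradient are unique, so any witnesses of
      \<open>solves_newton\<close> are the explicit ones; comparing at time 0, where
      \<open>q 0 = z0\<close>, suffices.\<close>
    have "v2 = v" using *(1) q' vector_derivative_unique_at by blast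
    then have "a 0 = - w\<^sup>2 *\<^sub>R q 0" using *(2) v' vector_derivative_unique_at by blast
    moreover have "a 0 = - ?c *\<^sub>R q 0" using *(3) grad GDERIV_unique by blast
    ultimately have "w\<^sup>2 *\<^sub>R z0 = ?c *\<^sub>R z0" by (simp add: q_def del: scaleR_cancel_right)
    moreover have "z0 $ 1 \<noteq> z0 $ 2" using z0_collision_free by (simp add: collision_free_def)
    then have "z0 \<noteq> 0" by auto
    ultimately show "w\<^sup>2 = ?c" by (simp only: scaleR_cancel_right simp_thms)
  qed
  then show ?thesis
    using assms by (simp add: relative_equilibrium_def rotation_z0 q_def[abs_def])
qed

section \<open>Derivative of the force and the Hessian\<close>

text \<open>Product rule for \<open>force\<close>: the first term varies the difference vector, the
  second the power of its norm, with \<open>\<alpha> * (\<alpha> + 2)\<close> arising as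
  \<open>(- \<alpha>) * (- \<alpha> - 2)\<close>. Summands with \<open>j = i\<close> vanish.\<close>

definition force_deriv :: "real \<Rightarrow> real^2^3 \<Rightarrow> real^2^3 \<Rightarrow> real^2^3" where
  "force_deriv \<alpha> q h = (\<chi> i. \<Sum>j\<in>UNIV.
     (- \<alpha> * norm (q $ i - q $ j) powr (- \<alpha> - 2)) *\<^sub>R (h $ i - h $ j)
     + (\<alpha> * (\<alpha> + 2) * norm (q $ i - q $ j) powr (- \<alpha> - 4)
         * ((q $ i - q $ j) \<bullet> (h $ i - h $ j))) *\<^sub>R (q $ i - q $ j))"

lemma has_derivative_vec_lambda:
  fixes f :: "'a::real_normed_vector \<Rightarrow> 'b::euclidean_space^'n"
  assumes "\<And>i. ((\<lambda>x. f x $ i) has_derivative (\<lambda>h. f' h $ i)) (at x)"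
  shows "(f has_derivative f') (at x)"
  unfolding has_derivative_componentwise_within[of f]
proof
  fix b :: "'b^'n" assume "b \<in> Basis"
  then obtain i u where b: "b = axis i u" by (auto simp: Basis_vec_def)
  show "((\<lambda>x. f x \<bullet> b) has_derivative (\<lambda>h. f' h \<bullet> b)) (at x)"
    unfolding b inner_axis by (intro has_derivative_inner_left assms)
qed

lemma force_has_derivative:
  assumes "collision_free q"
  shows "(force \<alpha> has_derivative force_deriv \<alpha> q) (at q)"
proof (rule has_derivative_vec_lambda)
  fix i
  have lin: "((\<lambda>q. q $ i - q $ j) has_derivative (\<lambda>h. h $ i - h $ j)) (at q)" for j
    by (intro has_derivative_diff bounded_linear_imp_has_derivative bounded_linear_vec_nth)
  have "((\<lambda>q. (- \<alpha> * norm (q $ i - q $ j) powr (- \<alpha> - 2)) *\<^sub>R (q $ i - q $ j)) has_derivative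
     (\<lambda>h. (- \<alpha> * norm (q $ i - q $ j) powr (- \<alpha> - 2)) *\<^sub>R (h $ i - h $ j)
     + (\<alpha> * (\<alpha> + 2) * norm (q $ i - q $ j) powr (- \<alpha> - 4)
         * ((q $ i - q $ j) \<bullet> (h $ i - h $ j))) *\<^sub>R (q $ i - q $ j))) (at q)" for j
  \<comment> \<open>For \<open>j = i\<close> the summand is identically zero; otherwise absence of
    collisions makes the power of the norm differentiable.\<close>
  proof (cases "j = i")
    case False
    then have "q $ i \<noteq> q $ j" using assms by (auto simp: collision_free_def)
    from has_derivative_scaleR[OF has_derivative_mult_right[OF pair_norm_powr_has_derivative[OF this]] lin]
    show ?thesis
      by (rule has_derivative_eq_rhs) (auto simp: fun_eq_iff algebra_simps)
  qed simp
  then show "((\<lambda>q. force \<alpha> q $ i) has_derivative (\<lambda>h. force_deriv \<alpha> q h $ i)) (at q)"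
    unfolding force_def force_deriv_def vec_lambda_beta by (intro has_derivative_sum)
qed

lemma hessian_potential:
  assumes "collision_free q"
  shows "hessian (potential \<alpha>) q = Matrix.mat 6 6 (\<lambda>(k, l). coord k \<bullet> force_deriv \<alpha> q (coord l))"
proof -
  have "(gradient (potential \<alpha>) has_derivative force_deriv \<alpha> q) (at q)"
    using force_has_derivative[OF assms] open_collision_free
    by (rule has_derivative_transform_within_open) (auto simp: assms gradient_potential)
  then show ?thesis
    unfolding hessian_def by (metis frechet_derivative_at)
qed

section \<open>Complexified coordinates and the deformation mode\<close>

text \<open>Coordinates of the complexified configuration \<open>x + \<i> * y\<close>, kept as a
  pair of real configurations.\<close>

definition complex_coords :: "real^2^3 \<Rightarrow> real^2^3 \<Rightarrow> complex Matrix.vec" where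
  "complex_coords x y = Matrix.vec 6 (\<lambda>k. Complex (coord k \<bullet> x) (coord k \<bullet> y))"

lemma coord_inner: "coord k \<bullet> x = x $ of_nat (k div 2 + 1) $ of_nat (k mod 2 + 1)"
  by (simp add: coord_def inner_axis')

lemma coord_inner_simps:
  "coord 0 \<bullet> x = x $ 1 $ 1" "coord (Suc 0) \<bullet> x = x $ 1 $ 2"
  "coord 2 \<bullet> x = x $ 2 $ 1" "coord 3 \<bullet> x = x $ 2 $ 2"
  "coord 4 \<bullet> x = x $ 3 $ 1" "coord 5 \<bullet> x = x $ 3 $ 2"
  by (simp_all add: coord_inner)

lemma sum_6: "(\<Sum>k = 0..<6. f k) = f 0 + f 1 + f 2 + f 3 + f 4 + f (5 :: nat)"
  by (simp add: eval_nat_numeral)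

lemma less_6_cases: "k < 6 \<Longrightarrow> k = 0 \<or> k = 1 \<or> k = 2 \<or> k = 3 \<or> k = 4 \<or> k = (5 :: nat)"
  by linarith

lemma coord_expansion: "(\<Sum>k = 0..<6. (coord k \<bullet> x) *\<^sub>R coord k) = x"
  by (simp add: sum_6 coord_inner_simps)
    (simp add: Finite_Cartesian_Product.vec_eq_iff forall_3 forall_2 coord_def axis_def)

text \<open>A real linear map acts separately on real and imaginary parts. This reduces the action
  of the Hessian to evaluating \<open>force_deriv\<close>, without computing any matrix
  entries.\<close>

lemma mult_complex_coords:
  assumes "linear D"
  shows "map_mat complex_of_real (Matrix.mat 6 6 (\<lambda>(k, l). coord k \<bullet> D (coord l))) *\<^sub>v complex_coords x y
    = complex_coords (D x) (D y)"
proof (rule eq_vecI)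
  have D: "coord k \<bullet> D u = (\<Sum>l = 0..<6. (coord k \<bullet> D (coord l)) * (coord l \<bullet> u))" for u k
    by (subst coord_expansion[symmetric, of u])
      (simp only: linear_sum[OF assms] linear_scale[OF assms] inner_sum_right inner_scaleR_right mult.commute)
  fix k assume "k < dim_vec (complex_coords (D x) (D y))"
  then show "vec_index (map_mat complex_of_real (Matrix.mat 6 6 (\<lambda>(k, l). coord k \<bullet> D (coord l)))
    *\<^sub>v complex_coords x y) k = vec_index (complex_coords (D x) (D y)) k"
    by (simp add: complex_coords_def scalar_prod_def complex_eq_iff D[of _ x] D[of _ y])
qed (simp add: complex_coords_def)

text \<open>
  The configuration \<open>a * \<zeta> powi (- k)\<close>, \<open>k = 0, 1, 2\<close>, for \<open>a = 1\<close> and \<open>a = \<i>\<close>; the complex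
  vector \<open>mode_re + \<i> * mode_im\<close> is the eigenvector of \<open>J6\<close> for \<open>\<i>\<close>.
\<close>
definition mode_re :: "real^2^3" where
  "mode_re = vector [vector [1, 0], vector [- 1/2, - (sqrt 3 / 2)], vector [- 1/2, sqrt 3 / 2]]"

definition mode_im :: "real^2^3" where
  "mode_im = vector [vector [0, 1], vector [sqrt 3 / 2, - 1/2], vector [- (sqrt 3 / 2), - 1/2]]"

text \<open>\<open>J6\<close> is the clockwise quarter turn of every particle: it sends
  \<open>mode_re\<close> to \<open>- mode_im\<close> and \<open>mode_im\<close> to
  \<open>mode_re\<close>.\<close>

lemma J6_mode:
  "map_mat complex_of_real J6 *\<^sub>v complex_coords mode_re mode_im
    = \<i> \<cdot>\<^sub>v complex_coords mode_re mode_im"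
proof (rule eq_vecI)
  fix k assume "k < dim_vec (\<i> \<cdot>\<^sub>v complex_coords mode_re mode_im)"
  then have "k < 6" by (simp add: complex_coords_def)
  from less_6_cases[OF this]
  show "vec_index (map_mat complex_of_real J6 *\<^sub>v complex_coords mode_re mode_im) k
    = vec_index (\<i> \<cdot>\<^sub>v complex_coords mode_re mode_im) k"
    by (elim disjE)
      (simp_all add: J6_def J2_def mat_of_rows_list_def Let_def complex_coords_def scalar_prod_def
        sum_6 coord_inner_simps complex_eq_iff mode_re_def mode_im_def)
qed (simp add: complex_coords_def J6_def J2_def mat_of_rows_list_def Let_def)

text \<open>Read the plane as the complex numbers, with \<open>d = z0 $ i - z0 $ j\<close> and
  \<open>e = h $ i - h $ j = a * cnj d\<close>. Then \<open>Re (d * cnj e) * d\<close> is half of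
  \<open>cnj a * d^3 + 3 * e\<close> for \<open>j \<noteq> i\<close>. The two cubes
  \<open>d^3\<close> are opposite imaginary numbers and cancel, and the differences \<open>e\<close>
  sum to three times \<open>h $ i\<close> because the mode is centred.\<close>

lemma sum_z0_mode:
  assumes "h = mode_re \<or> h = mode_im"
  shows "(\<Sum>j\<in>UNIV. ((z0 $ i - z0 $ j) \<bullet> (h $ i - h $ j)) *\<^sub>R (z0 $ i - z0 $ j)) = (9/2) *\<^sub>R h $ i"
    and "(\<Sum>j\<in>UNIV. h $ i - h $ j) = 3 *\<^sub>R h $ i"
proof -
  have z: "z0 $ 1 $ 1 = 1" "z0 $ 1 $ 2 = 0" "z0 $ 2 $ 1 = -1/2" "z0 $ 2 $ 2 = sqrt 3 / 2"
    "z0 $ 3 $ 1 = -1/2" "z0 $ 3 $ 2 = - (sqrt 3 / 2)"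
    by (simp_all add: z0_def)
  have m: "mode_re $ 1 $ 1 = 1" "mode_re $ 1 $ 2 = 0" "mode_re $ 2 $ 1 = -1/2" "mode_re $ 2 $ 2 = - (sqrt 3 / 2)"
    "mode_re $ 3 $ 1 = -1/2" "mode_re $ 3 $ 2 = sqrt 3 / 2"
    "mode_im $ 1 $ 1 = 0" "mode_im $ 1 $ 2 = 1" "mode_im $ 2 $ 1 = sqrt 3 / 2" "mode_im $ 2 $ 2 = -1/2"
    "mode_im $ 3 $ 1 = - (sqrt 3 / 2)" "mode_im $ 3 $ 2 = -1/2"
    by (simp_all add: mode_re_def mode_im_def)
  show "(\<Sum>j\<in>UNIV. ((z0 $ i - z0 $ j) \<bullet> (h $ i - h $ j)) *\<^sub>R (z0 $ i - z0 $ j)) = (9/2) *\<^sub>R h $ i"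
    using assms exhaust_3[of i]
    by (elim disjE; simp add: Finite_Cartesian_Product.vec_eq_iff forall_2 sum_3 sum_2 inner_vec_def
      z m field_simps)
  show "(\<Sum>j\<in>UNIV. h $ i - h $ j) = 3 *\<^sub>R h $ i"
    using assms exhaust_3[of i]
    by (elim disjE; simp add: Finite_Cartesian_Product.vec_eq_iff forall_2 sum_3 z m)
qed

lemma force_deriv_z0_mode:
  assumes "h = mode_re \<or> h = mode_im"
  shows "force_deriv \<alpha> z0 h = (3 powr (- \<alpha> / 2) * \<alpha> * \<alpha> / 2) *\<^sub>R h"
proof -
  define P where "P = 3 powr (- \<alpha> / 2)"
  have p: "sqrt 3 powr (- \<alpha> - 2) = P / 3" "sqrt 3 powr (- \<alpha> - 4) = P / 9"
    by (simp_all add: P_def powr_half_sqrt[symmetric] powr_powr powr_diff)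
  have n: "norm (z0 $ i - z0 $ j) = sqrt 3" if "i \<noteq> j" for i j
    using norm_rotated_z0_diff[OF that, of z0 0] by simp
  have "force_deriv \<alpha> z0 h $ i = (P * \<alpha> * \<alpha> / 2) *\<^sub>R h $ i" for i
  proof -
    have "force_deriv \<alpha> z0 h $ i = (\<Sum>j\<in>UNIV. (- \<alpha> * (P / 3)) *\<^sub>R (h $ i - h $ j)
        + (\<alpha> * (\<alpha> + 2) * (P / 9)) *\<^sub>R ((z0 $ i - z0 $ j) \<bullet> (h $ i - h $ j)) *\<^sub>R (z0 $ i - z0 $ j))"
      unfolding force_deriv_def vec_lambda_beta
    proof (intro sum.cong refl)
      fix j
      show "(- \<alpha> * norm (z0 $ i - z0 $ j) powr (- \<alpha> - 2)) *\<^sub>R (h $ i - h $ j)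
          + (\<alpha> * (\<alpha> + 2) * norm (z0 $ i - z0 $ j) powr (- \<alpha> - 4)
            * ((z0 $ i - z0 $ j) \<bullet> (h $ i - h $ j))) *\<^sub>R (z0 $ i - z0 $ j)
        = (- \<alpha> * (P / 3)) *\<^sub>R (h $ i - h $ j)
        + (\<alpha> * (\<alpha> + 2) * (P / 9)) *\<^sub>R ((z0 $ i - z0 $ j) \<bullet> (h $ i - h $ j)) *\<^sub>R (z0 $ i - z0 $ j)"
        \<comment> \<open>For \<open>i = j\<close> both difference vectors are zero, so the uniform
          coefficients are correct there as well.\<close>
        by (cases "i = j") (simp_all add: n p)
    qed
    also have "\<dots> = (- \<alpha> * (P / 3)) *\<^sub>R 3 *\<^sub>R h $ i + (\<alpha> * (\<alpha> + 2) * (P / 9)) *\<^sub>R (9/2) *\<^sub>R h $ i"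
      unfolding sum.distrib scaleR_sum_right[symmetric] sum_z0_mode[OF assms] ..
    \<comment> \<open>The scalar is
      \<open>P * \<alpha> * (- 1 + (\<alpha> + 2) / 2)\<close>.\<close>
    also have "\<dots> = (P * \<alpha> * \<alpha> / 2) *\<^sub>R h $ i"
      unfolding scaleR_scaleR scaleR_add_left[symmetric] by (simp add: field_simps)
    finally show ?thesis .
  qed
  then show ?thesis by (simp add: Finite_Cartesian_Product.vec_eq_iff P_def)
qed

lemma linear_force_deriv: "collision_free q \<Longrightarrow> linear (force_deriv \<alpha> q)"
  using force_has_derivative has_derivative_linear by blast

lemma hessian_z0_mode:
  "map_mat complex_of_real (hessian (potential \<alpha>) z0) *\<^sub>v complex_coords mode_re mode_im
    = complex_of_real (3 powr (- \<alpha> / 2) * \<alpha> * \<alpha> / 2) \<cdot>\<^sub>v complex_coords mode_re mode_im"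
  unfolding hessian_potential[OF z0_collision_free]
    mult_complex_coords[OF linear_force_deriv[OF z0_collision_free]]
  by (rule eq_vecI) (auto simp: complex_coords_def force_deriv_z0_mode complex_eq_iff)

section \<open>From a common eigenvector to an eigenvalue of the linearization\<close>

lemma smult_mat_mult_vec:
  fixes A :: "'a::comm_ring_1 mat"
  assumes "A \<in> carrier_mat nr n" "v \<in> carrier_vec n"
  shows "(k \<cdot>\<^sub>m A) *\<^sub>v v = k \<cdot>\<^sub>v (A *\<^sub>v v)"
  using assms by (intro eq_vecI) auto

lemma smult_append_vec: "k \<cdot>\<^sub>v (u @\<^sub>v v) = k \<cdot>\<^sub>v u @\<^sub>v k \<cdot>\<^sub>v v"
  by (rule eq_vecI) auto

text \<open>The eigenvector is \<open>v\<close> stacked on \<open>\<mu> \<cdot>\<^sub>v v\<close>,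
  position over velocity. The upper block row then holds automatically, and since \<open>v\<close>
  is an eigenvector of both the Hessian and \<open>J6\<close>, the lower one reduces to a scalar
  quadratic equation for \<open>\<mu>\<close>.\<close>

lemma eigenvalue_linearization:
  fixes \<mu> :: complex
  assumes v: "v \<in> carrier_vec 6" "v \<noteq> 0\<^sub>v 6"
    and H: "map_mat complex_of_real (hessian (potential \<alpha>) z) *\<^sub>v v = h \<cdot>\<^sub>v v"
    and J: "map_mat complex_of_real J6 *\<^sub>v v = j \<cdot>\<^sub>v v"
    and \<mu>: "\<mu>\<^sup>2 = (complex_of_real \<omega>)\<^sup>2 + h + 2 * complex_of_real \<omega> * j * \<mu>"
  shows "eigenvalue (map_mat complex_of_real (linearization \<alpha> \<omega> z)) \<mu>"
proof -
  let ?H = "map_mat complex_of_real (hessian (potential \<alpha>) z)"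
  let ?J = "map_mat complex_of_real J6"
  let ?w = "complex_of_real \<omega>"
  have H6 [simp]: "hessian (potential \<alpha>) z \<in> carrier_mat 6 6" and J6 [simp]: "J6 \<in> carrier_mat 6 6"
    by (rule carrier_matI; simp add: hessian_def J6_def J2_def mat_of_rows_list_def Let_def)+
  have L: "map_mat complex_of_real (linearization \<alpha> \<omega> z) =
      four_block_mat (0\<^sub>m 6 6) (1\<^sub>m 6) (?w\<^sup>2 \<cdot>\<^sub>m 1\<^sub>m 6 + ?H) ((2 * ?w) \<cdot>\<^sub>m ?J)"
  proof -
    have "map_mat complex_of_real (0\<^sub>m 6 6) = 0\<^sub>m 6 6" "map_mat complex_of_real (1\<^sub>m 6) = 1\<^sub>m 6"
      "map_mat complex_of_real (\<omega>\<^sup>2 \<cdot>\<^sub>m 1\<^sub>m 6 + hessian (potential \<alpha>) z) = ?w\<^sup>2 \<cdot>\<^sub>m 1\<^sub>m 6 + ?H"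
      "map_mat complex_of_real ((2 * \<omega>) \<cdot>\<^sub>m J6) = (2 * ?w) \<cdot>\<^sub>m ?J"
      using carrier_matD[OF H6] carrier_matD[OF J6] by (auto intro!: eq_matI)
    then show ?thesis
      unfolding linearization_def
      by (subst map_four_block_mat[of _ 6 6 _ 6 _ 6]) simp_all
  qed
  have top: "0\<^sub>m 6 6 *\<^sub>v v + 1\<^sub>m 6 *\<^sub>v (\<mu> \<cdot>\<^sub>v v) = \<mu> \<cdot>\<^sub>v v"
    using v by (simp, intro eq_vecI) (auto simp: scalar_prod_def)
  have "(?w\<^sup>2 \<cdot>\<^sub>m 1\<^sub>m 6 + ?H) *\<^sub>v v = ?w\<^sup>2 \<cdot>\<^sub>v v + h \<cdot>\<^sub>v v"
    using v by (simp add: add_mult_distrib_mat_vec[of _ 6 6] smult_mat_mult_vec[of _ 6 6] H)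
  moreover have "((2 * ?w) \<cdot>\<^sub>m ?J) *\<^sub>v (\<mu> \<cdot>\<^sub>v v) = (2 * ?w * \<mu> * j) \<cdot>\<^sub>v v"
    using v by (simp add: smult_mat_mult_vec[of _ 6 6] mult_mat_vec[of _ 6 6] J smult_smult_assoc mult_ac)
  ultimately have bottom: "(?w\<^sup>2 \<cdot>\<^sub>m 1\<^sub>m 6 + ?H) *\<^sub>v v + ((2 * ?w) \<cdot>\<^sub>m ?J) *\<^sub>v (\<mu> \<cdot>\<^sub>v v) = \<mu> \<cdot>\<^sub>v (\<mu> \<cdot>\<^sub>v v)"
    using v \<mu> by (simp add: smult_smult_assoc add_smult_distrib_vec[symmetric] power2_eq_square mult_ac)
  have "eigenvector (map_mat complex_of_real (linearization \<alpha> \<omega> z)) (v @\<^sub>v \<mu> \<cdot>\<^sub>v v) \<mu>"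
    unfolding eigenvector_def
  proof (intro conjI)
    show "map_mat complex_of_real (linearization \<alpha> \<omega> z) *\<^sub>v (v @\<^sub>v \<mu> \<cdot>\<^sub>v v) = \<mu> \<cdot>\<^sub>v (v @\<^sub>v \<mu> \<cdot>\<^sub>v v)"
      unfolding L using v
      by (subst four_block_mat_mult_vec[of _ 6 6 _ 6 _ 6]) (auto simp: top bottom smult_append_vec)
    show "v @\<^sub>v \<mu> \<cdot>\<^sub>v v \<noteq> 0\<^sub>v (dim_row (map_mat complex_of_real (linearization \<alpha> \<omega> z)))"
    proof
      assume *: "v @\<^sub>v \<mu> \<cdot>\<^sub>v v = 0\<^sub>v (dim_row (map_mat complex_of_real (linearization \<alpha> \<omega> z)))"
      \<comment> \<open>The first six entries of the stacked vector are those of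
        \<open>v\<close>.\<close>
      have "v = 0\<^sub>v 6"
      proof (rule eq_vecI)
        fix i assume "i < dim_vec (0\<^sub>v 6 :: complex Matrix.vec)"
        then show "vec_index v i = vec_index (0\<^sub>v 6) i"
          using arg_cong[OF *, of "\<lambda>u. vec_index u i"] v by (simp add: L)
      qed (use v in simp)
      with v show False by simp
    qed
    show "v @\<^sub>v \<mu> \<cdot>\<^sub>v v \<in> carrier_vec (dim_row (map_mat complex_of_real (linearization \<alpha> \<omega> z)))"
      unfolding L by (rule carrier_vecI) (simp add: carrier_vecD[OF v(1)] carrier_matD[OF J6])
  qed
  then show ?thesis unfolding eigenvalue_def by blast
qed

section \<open>Uniqueness of the angular velocity and the unstable eigenvalue\<close>

theorem mainTheorem1:
  fixes \<alpha> \<omega> :: real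
  assumes "\<alpha> > 0" and "\<omega> > 0" and "\<omega>\<^sup>2 = 3 powr (- \<alpha> / 2) * \<alpha>"
  shows "(\<forall>w. relative_equilibrium \<alpha> w z0 \<longleftrightarrow> w = \<omega>) \<and> linearly_unstable \<alpha> \<omega> z0"
proof
  \<comment> \<open>Squaring is injective on positive reals, and nonpositive \<open>w\<close> are
    excluded by the definition of a relative equilibrium.\<close>
  show "\<forall>w. relative_equilibrium \<alpha> w z0 \<longleftrightarrow> w = \<omega>"
  proof
    fix w
    show "relative_equilibrium \<alpha> w z0 \<longleftrightarrow> w = \<omega>"
    proof (cases "w > 0")
      case True
      then have "w\<^sup>2 = \<omega>\<^sup>2 \<longleftrightarrow> w = \<omega>" using \<open>\<omega> > 0\<close> by (auto simp: power2_eq_iff)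
      then show ?thesis using relative_equilibrium_z0_iff[OF True] assms(3) by simp
    qed (use \<open>\<omega> > 0\<close> in \<open>auto simp: relative_equilibrium_def\<close>)
  qed
next
  let ?v = "complex_coords mode_re mode_im"
  define \<mu> where "\<mu> = complex_of_real \<omega> * (complex_of_real (sqrt (\<alpha> / 2)) + \<i>)"
  have s: "(complex_of_real (sqrt (\<alpha> / 2)))\<^sup>2 = complex_of_real (\<alpha> / 2)"
    unfolding of_real_power[symmetric] of_real_eq_iff using \<open>\<alpha> > 0\<close> by simp
  have "\<mu>\<^sup>2 = (complex_of_real \<omega>)\<^sup>2 + (complex_of_real \<omega>)\<^sup>2 * (complex_of_real (sqrt (\<alpha> / 2)))\<^sup>2
      + 2 * complex_of_real \<omega> * \<i> * \<mu>"
    by (simp add: \<mu>_def power2_eq_square algebra_simps)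
  \<comment> \<open>Here the value of \<open>\<omega>\<^sup>2\<close> enters: it identifies
    \<open>\<omega>\<^sup>2 * \<alpha> / 2\<close> with the eigenvalue of the Hessian on the
    mode.\<close>
  also have "(complex_of_real \<omega>)\<^sup>2 * (complex_of_real (sqrt (\<alpha> / 2)))\<^sup>2
      = complex_of_real (3 powr (- \<alpha> / 2) * \<alpha> * \<alpha> / 2)"
    unfolding s by (simp add: of_real_power[symmetric] assms(3) del: of_real_power)
  finally have \<mu>: "\<mu>\<^sup>2 = (complex_of_real \<omega>)\<^sup>2 + complex_of_real (3 powr (- \<alpha> / 2) * \<alpha> * \<alpha> / 2)
      + 2 * complex_of_real \<omega> * \<i> * \<mu>" .
  have "vec_index ?v 0 \<noteq> 0"
    by (simp add: complex_coords_def coord_inner_simps mode_re_def complex_eq_iff)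
  then have "?v \<noteq> 0\<^sub>v 6" by auto
  from eigenvalue_linearization[OF _ this hessian_z0_mode J6_mode \<mu>]
  have "eigenvalue (map_mat complex_of_real (linearization \<alpha> \<omega> z0)) \<mu>"
    by (auto intro!: carrier_vecI simp: complex_coords_def)
  moreover have "Re \<mu> > 0" using assms by (simp add: \<mu>_def)
  ultimately show "linearly_unstable \<alpha> \<omega> z0" unfolding linearly_unstable_def by blast
qed

end
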